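(* Let $i,k$ be nonnegative integers and $j\ge 1$ an integer. For every integer $N\ge 0$, \[ F_N(i,j,k;x) = F_N(i,j-1,k;x) + x q^{N+i+j-1} F_{N-1} (i,j-1,k;x). \]
   Context: Gaussian binomial: ${A\brack B}_q=0$ if $B>A$ or $B<0$ (for all integers $A,B$), otherwise $\frac{(q;q)_A}{(q;q)_B(q;q)_{A-B}}$, with $(a;q)_n=\prod_{t=0}^{n-1}(1-aq^t)$. For nonnegative integers $i,j,k$ and integer $N$: $F_N(i,j,k;x)=0$ if $N<0$, and for $N\ge 0$ \[ F_N(i,j,k;x)=\sum_{m,n\geq 0} (-1)^n q^{\binom{(2k+1)n+1}{2} + m^2 + (2k+1)mn + i(m+n)} x^{m+(2k+1)n} {N-(2k+1)n-m+j\brack m}_q {N-2kn -m \brack n}_{q^{2k+1}}. \] *)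

theory Defs
  imports Complex_Main "HOL-Library.Groups_Big_Fun"
begin

text \<open>The variables q and x are elements of an arbitrary field. The Gaussian binomials are literal
  quotients, so they have their intended meaning when q is not a root of unity: then no (q;q)_n
  vanishes (lemma \<open>qpoch_nonzero\<close>), and the same holds for q^(2k+1) in place of q. This
  covers an indeterminate q (in a field of rational functions) as well as complex q with
  absolute value less than 1.\<close>

definition qpoch :: "'a::field \<Rightarrow> 'a \<Rightarrow> nat \<Rightarrow> 'a" where
  "qpoch a q n = (\<Prod>t<n. 1 - a * q ^ t)"

definition gauss_binom :: "'a::field \<Rightarrow> int \<Rightarrow> int \<Rightarrow> 'a" where
  "gauss_binom q A B =
     (if B > A \<or> B < 0 then 0
      else qpoch q q (nat A) / (qpoch q q (nat B) * qpoch q q (nat (A - B))))"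

definition F_term :: "'a::field \<Rightarrow> int \<Rightarrow> nat \<Rightarrow> nat \<Rightarrow> nat \<Rightarrow> 'a \<Rightarrow> nat \<Rightarrow> nat \<Rightarrow> 'a" where
  "F_term q N i j k x m n =
     (- 1) ^ n
     * q ^ ((((2 * k + 1) * n + 1) choose 2) + m ^ 2 + (2 * k + 1) * m * n + i * (m + n))
     * x ^ (m + (2 * k + 1) * n)
     * gauss_binom q (N - (2 * int k + 1) * int n - int m + int j) (int m)
     * gauss_binom (q ^ (2 * k + 1)) (N - 2 * int k * int n - int m) (int n)"

text \<open>Only finitely many terms of the double series are nonzero (lemma \<open>finite_F_term\<close>), so the
  series is the finite-support sum \<open>Sum_any\<close>; its default value for infinite support
  is never used.\<close>

definition F :: "'a::field \<Rightarrow> int \<Rightarrow> nat \<Rightarrow> nat \<Rightarrow> nat \<Rightarrow> 'a \<Rightarrow> 'a" where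
  "F q N i j k x = (if N < 0 then 0 else Sum_any (\<lambda>(m, n). F_term q N i j k x m n))"

lemma finite_F_term:
  "finite {p. (case p of (m, n) \<Rightarrow> F_term q N i j k x m n) \<noteq> 0}"
proof (rule finite_subset)
  show "{p. (case p of (m, n) \<Rightarrow> F_term q N i j k x m n) \<noteq> 0} \<subseteq> {..nat N} \<times> {..nat N}"
  proof clarify
    fix m n assume "F_term q N i j k x m n \<noteq> 0"
    then have "gauss_binom (q ^ (2 * k + 1)) (N - 2 * int k * int n - int m) (int n) \<noteq> 0"
      unfolding F_term_def by auto
    then have "int n \<le> N - 2 * int k * int n - int m"
      unfolding gauss_binom_def by (auto split: if_splits)
    moreover have "0 \<le> 2 * int k * int n" by simp
    ultimately have "int n \<le> N \<and> int m \<le> N" by linarith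
    then show "m \<in> {..nat N} \<and> n \<in> {..nat N}" by auto
  qed
qed auto

lemma qpoch_nonzero:
  fixes q :: "'a::field"
  assumes "\<And>n. n > 0 \<Longrightarrow> q ^ n \<noteq> 1"
  shows "qpoch q q n \<noteq> 0"
proof -
  have "1 - q * q ^ t \<noteq> 0" for t using assms[of "Suc t"] by simp
  then show ?thesis unfolding qpoch_def by simp
qed

end

theory Submission
  imports Defs
begin

text \<open>Apply the \<open>q\<close>-Pascal rule
  \<open>[A, m] = [A - 1, m] + q^(A - m) [A - 1, m - 1]\<close> with \<open>A = N - (2k+1)n - m + j\<close> to the first
  Gaussian binomial of every summand. The first part is the summand of \<open>F_N(i, j-1, k; x)\<close>; in the
  second part the substitution \<open>m \<rightarrow> m + 1\<close> turns the exponent of \<open>q\<close> into that of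
  \<open>F_(N-1)(i, j-1, k; x)\<close> plus \<open>N + i + j - 1\<close>. The rule fails only at \<open>A = m = 0\<close>, and there
  \<open>j \<ge> 1\<close> makes the second Gaussian binomial vanish.\<close>

lemma qpoch_Suc: "qpoch a q (Suc n) = qpoch a q n * (1 - a * q ^ n)"
  by (simp add: qpoch_def)

lemma gauss_binom_eq_0: "B > A \<or> B < 0 \<Longrightarrow> gauss_binom q A B = 0"
  by (simp add: gauss_binom_def)

lemma gauss_binom_0_right:
  fixes q :: "'a::field"
  assumes "\<And>n. n > 0 \<Longrightarrow> q ^ n \<noteq> 1" and "A \<ge> 0"
  shows "gauss_binom q A 0 = 1"
  using qpoch_nonzero[OF assms(1)] assms(2) by (simp add: gauss_binom_def) (simp add: qpoch_def)

lemma gauss_binom_of_nat: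
  "gauss_binom q (int (a + b)) (int b) = qpoch q q (a + b) / (qpoch q q b * qpoch q q a)"
proof -
  have "nat (int (a + b) - int b) = a" by simp
  then show ?thesis unfolding gauss_binom_def by (simp only: nat_int) simp
qed

text \<open>Clearing denominators leaves
  \<open>1 - q^(a+m+1) = (1 - q^a) + q^a * (1 - q^(m+1))\<close> with \<open>a = A - (m+1)\<close>.
  For \<open>a < 0\<close> every binomial vanishes, so truncation by \<open>nat\<close> is harmless.
  Lower index \<open>Suc m\<close> avoids the exception \<open>A = m = 0\<close>.\<close>

lemma gauss_binom_pascal:
  fixes q :: "'a::field"
  assumes q: "\<And>n. n > 0 \<Longrightarrow> q ^ n \<noteq> 1"
  shows "gauss_binom q A (int (Suc m)) =
    gauss_binom q (A - 1) (int (Suc m)) + q ^ nat (A - int (Suc m)) * gauss_binom q (A - 1) (int m)"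
proof (cases "A < int (Suc m)")
  case True
  then show ?thesis by (simp add: gauss_binom_eq_0)
next
  case False
  define a where "a = nat (A - int (Suc m))"
  have A: "A = int (a + Suc m)" and A1: "A - 1 = int (a + m)"
    using False by (auto simp: a_def)
  have nz: "qpoch q q n \<noteq> 0" for n using qpoch_nonzero[OF q] .
  have fac: "1 - q * q ^ n \<noteq> 0" for n using q[of "Suc n"] by simp
  have e: "nat (A - int (Suc m)) = a" by (simp add: a_def)
  show ?thesis
  proof (cases a)
    \<comment> \<open>Here \<open>A - 1 = m\<close>, so the first binomial on the right is zero by
      convention rather than a quotient.\<close>
    case 0
    then show ?thesis unfolding e A1 unfolding A
      using nz by (simp add: gauss_binom_def)
  next
    case (Suc b)
    have A2: "a + m = b + Suc m" using Suc by simp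
    define u where "u = 1 - q * q ^ m"
    define v where "v = 1 - q * q ^ b"
    have uv: "u \<noteq> 0" "v \<noteq> 0" "1 - q * q ^ (a + m) = v + q ^ a * u"
      using fac by (simp_all add: u_def v_def Suc power_add algebra_simps)
    have Sucs: "qpoch q q (Suc m) = qpoch q q m * u" "qpoch q q a = qpoch q q b * v"
      by (simp_all add: qpoch_Suc u_def v_def Suc)
    have 1: "gauss_binom q (A - 1) (int (Suc m)) =
        qpoch q q (a + m) / (qpoch q q m * u * qpoch q q b)"
      unfolding A1 A2 gauss_binom_of_nat Sucs ..
    have 2: "gauss_binom q (A - 1) (int m) =
        qpoch q q (a + m) / (qpoch q q m * (qpoch q q b * v))"
      unfolding A1 gauss_binom_of_nat Sucs ..
    have 3: "gauss_binom q A (int (Suc m)) =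
        qpoch q q (a + m) * (v + q ^ a * u) / (qpoch q q m * u * (qpoch q q b * v))"
      unfolding A gauss_binom_of_nat Sucs by (simp add: qpoch_Suc uv(3))
    show ?thesis
      unfolding e 1 2 3 using nz[of m] nz[of b] uv(1,2) by (simp add: field_simps)
  qed
qed

text \<open>The second Gaussian binomial has upper index below \<open>n\<close>; hence the bound
  does not involve \<open>j\<close>.\<close>

lemma F_term_eq_0: "N < (2 * int k + 1) * int n + int m \<Longrightarrow> F_term q N i j k x m n = 0"
  unfolding F_term_def by (simp add: gauss_binom_eq_0 algebra_simps)

lemma F_term_eq_0_if_less_add:
  assumes "N < int m + int n"
  shows "F_term q N i j k x m n = 0"
proof (rule F_term_eq_0)
  have "0 \<le> 2 * int k * int n" by simp
  then show "N < (2 * int k + 1) * int n + int m"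
    using assms unfolding distrib_right by linarith
qed

text \<open>Nonzero terms need \<open>m + n \<le> N\<close>, so any square of side at least
  \<open>N\<close> contains the support. For negative \<open>N\<close> all terms vanish, in
  agreement with the default value of \<open>F\<close>.\<close>

lemma F_eq_sum:
  assumes "N \<le> int M"
  shows "F q N i j k x = (\<Sum>m\<le>M. \<Sum>n\<le>M. F_term q N i j k x m n)"
proof (cases "N < 0")
  case True
  have "F_term q N i j k x m n = 0" for m n
    by (rule F_term_eq_0_if_less_add) (use True in simp)
  then show ?thesis using True by (simp add: F_def)
next
  case False
  have "F_term q N i j k x m n = 0" if "m > M \<or> n > M" for m n
    by (rule F_term_eq_0_if_less_add) (use that assms in linarith)
  then have "{p. (case p of (m, n) \<Rightarrow> F_term q N i j k x m n) \<noteq> 0} \<subseteq> {..M} \<times> {..M}"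
    by (force simp: not_le[symmetric])
  then show ?thesis
    using False by (simp add: F_def Sum_any.expand_superset sum.cartesian_product)
qed

text \<open>If the second binomial is nonzero, the upper index of the first is nonnegative for both
  \<open>j\<close> and \<open>Suc j\<close>, so the first is 1 in both terms.\<close>

lemma F_term_0_left:
  fixes q :: "'a::field"
  assumes "\<And>n. n > 0 \<Longrightarrow> q ^ n \<noteq> 1"
  shows "F_term q N i (Suc j) k x 0 n = F_term q N i j k x 0 n"
proof (cases "N < (2 * int k + 1) * int n")
  case True
  then show ?thesis by (simp add: F_term_eq_0)
next
  case False
  then show ?thesis by (simp add: F_term_def gauss_binom_0_right[OF assms])
qed

lemma F_term_Suc_left:
  fixes q :: "'a::field"
  assumes q: "\<And>n. n > 0 \<Longrightarrow> q ^ n \<noteq> 1" and N: "N \<ge> 0"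
  shows "F_term q N i (Suc j) k x (Suc m) n =
    F_term q N i j k x (Suc m) n + x * q ^ (nat N + i + j) * F_term q (N - 1) i j k x m n"
proof -
  define K where "K = 2 * k + 1"
  \<comment> \<open>\<open>A\<close> is the upper index on the left; both terms on the right have
    \<open>A - 1\<close>. The second binomial \<open>c\<close> is common to all three, since
    lowering \<open>N\<close> offsets lowering \<open>m\<close>.\<close>
  define A where "A = N - int K * int n - int m + int j"
  define c where "c = gauss_binom (q ^ K) (N - 2 * int k * int n - int (Suc m)) (int n)"
  define e where "e = ((K * n + 1) choose 2) + m ^ 2 + K * m * n + i * (m + n)"
  define e' where "e' = ((K * n + 1) choose 2) + (Suc m) ^ 2 + K * Suc m * n + i * (Suc m + n)"
  define y where "y = (- 1) ^ n * x ^ (m + K * n) * c"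
  have K: "2 * int k + 1 = int K" by (simp add: K_def)
  have 1: "F_term q N i (Suc j) k x (Suc m) n = x * y * q ^ e' * gauss_binom q A (int (Suc m))"
    unfolding F_term_def K K_def[symmetric] y_def c_def e'_def A_def
    by (simp add: algebra_simps)
  have 2: "F_term q N i j k x (Suc m) n = x * y * q ^ e' * gauss_binom q (A - 1) (int (Suc m))"
    unfolding F_term_def K K_def[symmetric] y_def c_def e'_def A_def
    by (simp add: algebra_simps)
  have 3: "F_term q (N - 1) i j k x m n = y * q ^ e * gauss_binom q (A - 1) (int m)"
    unfolding F_term_def K K_def[symmetric] y_def c_def e_def A_def
    by (simp add: algebra_simps)
  have shift: "q ^ e' * (q ^ nat (A - int (Suc m)) * gauss_binom q (A - 1) (int m)) =
      q ^ (nat N + i + j) * (q ^ e * gauss_binom q (A - 1) (int m))"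
  proof (cases "A < int (Suc m)")
    case True
    then show ?thesis by (simp add: gauss_binom_eq_0)
  next
    case False
    \<comment> \<open>\<open>e' - e = 2*m + 1 + K*n + i\<close>, and the Pascal exponent is
      \<open>N - K*n - 2*m - 1 + j\<close>; they add up to \<open>N + i + j\<close>.\<close>
    have "int (e' + nat (A - int (Suc m))) = int (nat N + i + j + e)"
      using False N unfolding e_def e'_def A_def
      by (simp add: algebra_simps power2_eq_square)
    then have "e' + nat (A - int (Suc m)) = nat N + i + j + e"
      by (simp only: of_nat_eq_iff)
    then show ?thesis by (metis (no_types) mult.assoc power_add)
  qed
  have "F_term q N i (Suc j) k x (Suc m) n = x * y * q ^ e' * gauss_binom q (A - 1) (int (Suc m)) +
      x * y * (q ^ e' * (q ^ nat (A - int (Suc m)) * gauss_binom q (A - 1) (int m)))"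
    unfolding 1 by (simp only: gauss_binom_pascal[OF q, of A m] distrib_left mult.assoc)
  then show ?thesis
    unfolding shift 2 3 by (simp only: mult_ac)
qed

theorem theorem2p3:
  fixes q x :: "'a::field" and i j k :: nat and N :: int
  assumes "\<And>n::nat. n > 0 \<Longrightarrow> q ^ n \<noteq> 1"
    and "j \<ge> 1"
    and "N \<ge> 0"
  shows "F q N i j k x =
           F q N i (j - 1) k x + x * q powi (N + int i + int j - 1) * F q (N - 1) i (j - 1) k x"
proof -
  obtain l where j: "j = Suc l" using assms(2) by (cases j) auto
  define M where "M = nat N"
  define T where "T = (\<lambda>N j m n. F_term q N i j k x m n)"
  define c where "c = x * q ^ (nat N + i + l)"
  have "N + int i + int j - 1 = int (nat N + i + l)" using assms(3) j by simp
  then have c: "x * q powi (N + int i + int j - 1) = c"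
    by (simp only: power_int_of_nat c_def)
  have S: "F q N i h k x = (\<Sum>m\<le>Suc M. \<Sum>n\<le>Suc M. T N h m n)" for h
    unfolding T_def by (rule F_eq_sum) (simp add: M_def)
  \<comment> \<open>Adding the zero column \<open>n = Suc M\<close> gives the sum for
    \<open>N - 1\<close> the same inner range as the sum for \<open>N\<close>; its rows
    \<open>m \<le> M\<close> match the rows \<open>Suc m\<close> left after row 0 is split
    off.\<close>
  have vanish: "T (N - 1) l m (Suc M) = 0" for m
    unfolding T_def by (rule F_term_eq_0_if_less_add) (simp add: M_def)
  have S': "F q (N - 1) i l k x = (\<Sum>m\<le>M. \<Sum>n\<le>Suc M. T (N - 1) l m n)"
    using F_eq_sum[of "N - 1" M q i l k x] vanish assms(3) by (simp add: M_def T_def)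
  have "F q N i j k x = (\<Sum>n\<le>Suc M. T N l 0 n) +
      (\<Sum>m\<le>M. \<Sum>n\<le>Suc M. T N l (Suc m) n + c * T (N - 1) l m n)"
    unfolding S sum.atMost_Suc_shift[of _ M] j
    by (simp only: T_def c_def F_term_0_left[OF assms(1)] F_term_Suc_left[OF assms(1,3)])
  also have "\<dots> = F q N i l k x + c * F q (N - 1) i l k x"
    unfolding S S' sum.atMost_Suc_shift[of "\<lambda>m. \<Sum>n\<le>Suc M. T N l m n" M]
    by (simp only: sum.distrib sum_distrib_left add.assoc)
  finally show ?thesis unfolding c by (simp add: j)
qed

end
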